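(* Consider a process $(\mathbf X,\mathbf Y,\mathbf Z)$ with data-generating process $$X_t=h_X(X_{t-1},\dots,X_{t-q_X},Y_{t-1},\dots,Y_{t-q_X},\mathbf Z_{t-1},\dots,\mathbf Z_{t-q_X},\varepsilon^X_t),$$ $$Y_t=h_Y(X_{t-1},\dots,X_{t-q_Y},Y_{t-1},\dots,Y_{t-q_Y},\mathbf Z_{t-1},\dots,\mathbf Z_{t-q_Y},\varepsilon^Y_t)$$ for all $t\in\mathbb Z$, where $q_X,q_Y\in\mathbb N$ and $h_X,h_Y$ are measurable. Then for every $p\in\mathbb N$, $$\mathbf X\overset{\mathrm{ext}(p)}{\longrightarrow}\mathbf Y\implies\mathbf X\overset{\mathrm{tail}(p)}{\longrightarrow}\mathbf Y\implies\mathbf X\overset{\mathrm{Sims}}{\to}\mathbf Y.$$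
   Context: $X_t,Y_t$ are real-valued, supported on some neighborhood of infinity, $\mathbf Z_t$ is finite-dimensional; $\varepsilon^X_t,\varepsilon^Y_t$ are noise variables. $F$ is a cumulative distribution function with $F(x)<1$ for all $x\in\mathbb R$. Let $\mathcal C_t^{-X_t}=\sigma(X_s:s<t;\ Y_s,\mathbf Z_s:s\le t)$. For $p\in\mathbb N$ define $$\Gamma^t_{\mathbf X\to\mathbf Y\mid\mathcal C}(p)=\lim_{v\to\infty}\mathbb E[\max\{F(Y_{t+1}),\dots,F(Y_{t+p})\}\mid X_t>v,\mathcal C_t^{-X_t}],$$ $$\Gamma^{t,\mathrm{baseline}}_{\mathbf X\to\mathbf Y\mid\mathcal C}(p)=\mathbb E[\max\{F(Y_{t+1}),\dots,F(Y_{t+p})\}\mid\mathcal C_t^{-X_t}],$$ the limit being assumed to exist a.s., where $\mathbb E[\,\cdot\mid X_t>v,\mathcal G]=\mathbb E[\,\cdot\,\mathbf 1\{X_t>v\}\mid\mathcal G]/P(X_t>v\mid\mathcal G)$. $\mathbf X\overset{\mathrm{tail}(p)}{\longrightarrow}\mathbf Y$: for some $t\in\mathbb Z$, $\Gamma^t_{\mathbf X\to\mathbf Y\mid\mathcal C}(p)$ and $\Gamma^{t,\mathrm{baseline}}_{\mathbf X\to\mathbf Y\mid\mathcal C}(p)$ are not a.s. equal. $\mathbf X\overset{\mathrm{ext}(p)}{\longrightarrow}\mathbf Y$: for some $t\in\mathbb Z$, $\Gamma^t_{\mathbf X\to\mathbf Y\mid\mathcal C}(p)=1$ a.s. $\mathbf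 X\overset{\mathrm{Sims}}{\to}\mathbf Y$: for some $t\in\mathbb Z$, $\{Y_{t+s}:s\ge1\}$ is not conditionally independent of $X_t$ given $\mathcal C_t^{-X_t}$. The notation without "$\mid\mathbf Z$" presupposes the convention that the conditioning set $\mathcal C_t^{-X_t}$ is causally sufficient (enlarging it by further admissible information available up to time $t$ does not change whether the relations hold). *)

theory Defs
  imports "HOL-Probability.Probability"
begin

definition family_sets ::
    "'w measure \<Rightarrow> ('i \<Rightarrow> 'w \<Rightarrow> 'b::topological_space) \<Rightarrow> 'i set \<Rightarrow> 'w set set" where
  "family_sets M V I = (\<Union>i\<in>I. {V i -` A \<inter> space M |A. A \<in> sets borel})"

definition past_sigma ::
    "'w measure \<Rightarrow> (int \<Rightarrow> 'w \<Rightarrow> real) \<Rightarrow> (int \<Rightarrow> 'w \<Rightarrow> real)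
      \<Rightarrow> (int \<Rightarrow> 'w \<Rightarrow> 'z::euclidean_space) \<Rightarrow> int \<Rightarrow> 'w measure" where
  "past_sigma M X Y Z t =
     sigma (space M) (family_sets M X {..<t} \<union> family_sets M Y {..t} \<union> family_sets M Z {..t})"

definition law_support :: "'a::topological_space measure \<Rightarrow> 'a set" where
  "law_support N = {x. \<forall>U. open U \<longrightarrow> x \<in> U \<longrightarrow> 0 < emeasure N U}"

text \<open>Lags are counted from 1; the vector lives in the product space over \<open>{1..q}\<close>.\<close>

definition lag_vec :: "nat \<Rightarrow> (int \<Rightarrow> 'w \<Rightarrow> 'b) \<Rightarrow> int \<Rightarrow> 'w \<Rightarrow> nat \<Rightarrow> 'b" where
  "lag_vec q V t \<omega> = (\<lambda>i\<in>{1..q}. V (t - int i) \<omega>)"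

abbreviation lag_space :: "nat \<Rightarrow> (nat \<Rightarrow> 'b::topological_space) measure" where
  "lag_space q \<equiv> PiM {1..q} (\<lambda>_. borel)"

definition future_max ::
    "(real \<Rightarrow> real) \<Rightarrow> (int \<Rightarrow> 'w \<Rightarrow> real) \<Rightarrow> nat \<Rightarrow> int \<Rightarrow> 'w \<Rightarrow> real" where
  "future_max F Y p t \<omega> = Max ((\<lambda>k. F (Y (t + int k) \<omega>)) ` {1..p})"

text \<open>\<open>E[f | A, G] = E[f 1_A | G] / P(A | G)\<close>; meaningful only where \<open>P(A | G) > 0\<close>.\<close>

definition event_cond_exp ::
    "'w measure \<Rightarrow> 'w measure \<Rightarrow> 'w set \<Rightarrow> ('w \<Rightarrow> real) \<Rightarrow> 'w \<Rightarrow> real" where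
  "event_cond_exp M G A f \<omega> =
     real_cond_exp M G (\<lambda>x. f x * indicator A x) \<omega> / real_cond_exp M G (indicator A) \<omega>"

text \<open>\<open>g\<close> is the almost sure limit of \<open>E[f | X > v, G]\<close> as \<open>v\<close> tends to infinity.  The first
  conjunct says that all the quotients are well defined (without it, division by zero would
  silently give 0).  Each quotient is determined only up to a null set and \<open>v\<close> ranges over an
  uncountable set, so the limit is taken along a suitable family \<open>r\<close> of versions; by restriction
  to integer \<open>v\<close>, the limit is almost surely independent of the choice of \<open>r\<close>.\<close>

definition has_tail_limit ::
    "'w measure \<Rightarrow> 'w measure \<Rightarrow> ('w \<Rightarrow> real) \<Rightarrow> ('w \<Rightarrow> real) \<Rightarrow> ('w \<Rightarrow> real) \<Rightarrow> bool" where
  "has_tail_limit M G X f g \<longleftrightarrow>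
     (\<forall>v. AE \<omega> in M. real_cond_exp M G (indicator {x \<in> space M. X x > v}) \<omega> > 0) \<and>
     g \<in> borel_measurable G \<and>
     (\<exists>r. (\<forall>v. r v \<in> borel_measurable G \<and>
               (AE \<omega> in M. r v \<omega> = event_cond_exp M G {x \<in> space M. X x > v} f \<omega>)) \<and>
          (AE \<omega> in M. ((\<lambda>v. r v \<omega>) \<longlongrightarrow> g \<omega>) at_top))"

definition Gamma_exists ::
    "'w measure \<Rightarrow> (int \<Rightarrow> 'w \<Rightarrow> real) \<Rightarrow> (int \<Rightarrow> 'w \<Rightarrow> real)
      \<Rightarrow> (int \<Rightarrow> 'w \<Rightarrow> 'z::euclidean_space) \<Rightarrow> (real \<Rightarrow> real) \<Rightarrow> nat \<Rightarrow> int \<Rightarrow> bool" where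
  "Gamma_exists M X Y Z F p t \<longleftrightarrow>
     (\<exists>g. has_tail_limit M (past_sigma M X Y Z t) (X t) (future_max F Y p t) g)"

text \<open>A version of the limit, determined up to a null set when \<open>Gamma_exists\<close> holds.\<close>

definition Gamma_tail ::
    "'w measure \<Rightarrow> (int \<Rightarrow> 'w \<Rightarrow> real) \<Rightarrow> (int \<Rightarrow> 'w \<Rightarrow> real)
      \<Rightarrow> (int \<Rightarrow> 'w \<Rightarrow> 'z::euclidean_space) \<Rightarrow> (real \<Rightarrow> real) \<Rightarrow> nat \<Rightarrow> int \<Rightarrow> 'w \<Rightarrow> real" where
  "Gamma_tail M X Y Z F p t =
     (SOME g. has_tail_limit M (past_sigma M X Y Z t) (X t) (future_max F Y p t) g)"

definition Gamma_baseline ::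
    "'w measure \<Rightarrow> (int \<Rightarrow> 'w \<Rightarrow> real) \<Rightarrow> (int \<Rightarrow> 'w \<Rightarrow> real)
      \<Rightarrow> (int \<Rightarrow> 'w \<Rightarrow> 'z::euclidean_space) \<Rightarrow> (real \<Rightarrow> real) \<Rightarrow> nat \<Rightarrow> int \<Rightarrow> 'w \<Rightarrow> real" where
  "Gamma_baseline M X Y Z F p t =
     real_cond_exp M (past_sigma M X Y Z t) (future_max F Y p t)"

definition tail_causes ::
    "'w measure \<Rightarrow> (int \<Rightarrow> 'w \<Rightarrow> real) \<Rightarrow> (int \<Rightarrow> 'w \<Rightarrow> real)
      \<Rightarrow> (int \<Rightarrow> 'w \<Rightarrow> 'z::euclidean_space) \<Rightarrow> (real \<Rightarrow> real) \<Rightarrow> nat \<Rightarrow> bool" where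
  "tail_causes M X Y Z F p \<longleftrightarrow>
     (\<exists>t. \<not> (AE \<omega> in M. Gamma_tail M X Y Z F p t \<omega> = Gamma_baseline M X Y Z F p t \<omega>))"

definition ext_causes ::
    "'w measure \<Rightarrow> (int \<Rightarrow> 'w \<Rightarrow> real) \<Rightarrow> (int \<Rightarrow> 'w \<Rightarrow> real)
      \<Rightarrow> (int \<Rightarrow> 'w \<Rightarrow> 'z::euclidean_space) \<Rightarrow> (real \<Rightarrow> real) \<Rightarrow> nat \<Rightarrow> bool" where
  "ext_causes M X Y Z F p \<longleftrightarrow> (\<exists>t. AE \<omega> in M. Gamma_tail M X Y Z F p t \<omega> = 1)"

definition cond_indep_sigma ::
    "'w measure \<Rightarrow> 'w measure \<Rightarrow> 'w measure \<Rightarrow> 'w measure \<Rightarrow> bool" where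
  "cond_indep_sigma M G H K \<longleftrightarrow>
     (\<forall>A\<in>sets H. \<forall>B\<in>sets K. AE \<omega> in M.
        real_cond_exp M G (indicator (A \<inter> B)) \<omega> =
        real_cond_exp M G (indicator A) \<omega> * real_cond_exp M G (indicator B) \<omega>)"

definition sims_causes ::
    "'w measure \<Rightarrow> (int \<Rightarrow> 'w \<Rightarrow> real) \<Rightarrow> (int \<Rightarrow> 'w \<Rightarrow> real)
      \<Rightarrow> (int \<Rightarrow> 'w \<Rightarrow> 'z::euclidean_space) \<Rightarrow> bool" where
  "sims_causes M X Y Z \<longleftrightarrow>
     (\<exists>t. \<not> cond_indep_sigma M (past_sigma M X Y Z t)
            (sigma (space M) (family_sets M Y {t<..}))
            (sigma (space M) (family_sets M X {t})))"

end

theory Submission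
  imports Defs
begin

text \<open>
  If the maximum \<open>f\<close> of the future values is less than 1 everywhere, then so is \<open>E[f | G]\<close> almost
  surely, so a tail coefficient equal to 1 cannot agree with the baseline.  Conversely, without Sims
  causality the factorisation \<open>E[f 1_B | G] = E[f | G] P(B | G)\<close> holds for each event
  \<open>B = {X_t > v}\<close>, so every quotient \<open>E[f | X_t > v, G]\<close> already equals \<open>E[f | G]\<close>, and hence so
  does the limit.
\<close>

lemma finite_measure_subalgebraI:
  assumes "finite_measure M" and "subalgebra M G"
  shows "finite_measure_subalgebra M G"
  using assms by (simp add: finite_measure_subalgebra_def finite_measure_subalgebra_axioms_def)

lemma subalgebra_sigma_generated:
  assumes "S \<subseteq> sets M"
  shows "subalgebra M (sigma (space M) S)"
proof -
  have "S \<subseteq> Pow (space M)"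
    using assms sets.space_closed by blast
  then show ?thesis
    using assms by (simp add: subalgebra_def sets.sigma_sets_subset)
qed

lemma family_sets_subset_sets:
  assumes "\<And>i. V i \<in> borel_measurable M"
  shows "family_sets M V I \<subseteq> sets M"
  using assms by (auto simp: family_sets_def measurable_sets)

lemma borel_measurable_sigma_family_sets:
  fixes V :: "'i \<Rightarrow> 'w \<Rightarrow> 'b::topological_space"
  assumes "\<And>i. V i \<in> borel_measurable M" and "i \<in> I"
  shows "V i \<in> borel_measurable (sigma (space M) (family_sets M V I))"
proof (rule measurableI)
  have sub: "family_sets M V I \<subseteq> Pow (space M)"
    using family_sets_subset_sets[of V M I] assms(1) sets.space_closed by blast
  fix A :: "'b set" assume "A \<in> sets borel"
  then have "V i -` A \<inter> space M \<in> family_sets M V I"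
    using assms(2) by (auto simp: family_sets_def)
  then show "V i -` A \<inter> space (sigma (space M) (family_sets M V I))
      \<in> sets (sigma (space M) (family_sets M V I))"
    using sub by simp
qed simp

text \<open>Conditional independence only speaks of indicators of events in \<open>H\<close>, while
  the tail coefficients need it for a bounded function of the future. Integrating both sides over
  \<open>C\<close> in \<open>G\<close>, the claim says that \<open>f\<close> is orthogonal to the
  indicator of \<open>C\<close> times the difference between the indicator of \<open>B\<close> and
  its conditional expectation given \<open>G\<close>. Events of \<open>H\<close> do not see that
  product, so neither does an \<open>H\<close>-measurable \<open>f\<close>.\<close>

lemma cond_indep_sigma_real_cond_exp_mult:
  assumes "prob_space M"
    and GM: "subalgebra M G" and HM: "subalgebra M H" and KM: "subalgebra M K"
    and ci: "cond_indep_sigma M G H K"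
    and B: "B \<in> sets K"
    and f_int: "integrable M f" and f_H: "f \<in> borel_measurable H"
  shows "AE \<omega> in M. real_cond_exp M G (\<lambda>x. f x * indicator B x) \<omega>
           = real_cond_exp M G f \<omega> * real_cond_exp M G (indicator B) \<omega>"
proof -
  interpret prob_space M by fact
  interpret G: finite_measure_subalgebra M G
    by (rule finite_measure_subalgebraI[OF finite_measure_axioms GM])
  interpret H: finite_measure_subalgebra M H
    by (rule finite_measure_subalgebraI[OF finite_measure_axioms HM])
  have BM: "B \<in> sets M"
    using B KM by (auto simp: subalgebra_def)
  define q :: "'a \<Rightarrow> real" where "q = real_cond_exp M G (indicator B)"
  have ind_int: "integrable M (indicator A :: 'a \<Rightarrow> real)" if "A \<in> sets M" for A
    using that by (simp add: emeasure_eq_measure)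
  have q_G [measurable]: "q \<in> borel_measurable G"
    by (simp add: q_def)
  have q_M [measurable]: "q \<in> borel_measurable M"
    by (simp add: q_def)
  have q_ge: "AE x in M. 0 \<le> q x"
    unfolding q_def by (rule G.real_cond_exp_ge_c[OF ind_int[OF BM]]) simp
  have q_le: "AE x in M. q x \<le> 1"
    unfolding q_def by (rule G.real_cond_exp_le_c[OF ind_int[OF BM]]) (simp add: indicator_def)
  \<comment> \<open>As a conditional probability, \<open>q\<close> lies in [0,1] almost surely, so
    multiplying by it preserves integrability.\<close>
  have mult_q_int: "integrable M (\<lambda>x. u x * q x)" if "integrable M u" for u :: "'a \<Rightarrow> real"
  proof (rule Bochner_Integration.integrable_bound[OF that])
    show "(\<lambda>x. u x * q x) \<in> borel_measurable M"
      using that by measurable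
    show "AE x in M. norm (u x * q x) \<le> norm (u x)"
      using q_ge q_le by eventually_elim (simp add: abs_mult mult_left_le)
  qed
  have mult_ind_int: "integrable M (\<lambda>x. u x * indicator A x)"
    if "integrable M u" "A \<in> sets M" for u :: "'a \<Rightarrow> real" and A
    using integrable_real_mult_indicator[OF that(2,1)] .
  have "AE \<omega> in M. real_cond_exp M G (\<lambda>x. f x * indicator B x) \<omega> = real_cond_exp M G f \<omega> * q \<omega>"
  proof (rule G.real_cond_exp_charact)
    show "integrable M (\<lambda>x. f x * indicator B x)"
      by (rule mult_ind_int[OF f_int BM])
    show "integrable M (\<lambda>x. real_cond_exp M G f x * q x)"
      by (rule mult_q_int[OF G.real_cond_exp_int(1)[OF f_int]])
    show "(\<lambda>x. real_cond_exp M G f x * q x) \<in> borel_measurable G"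
      by measurable
  next
    fix C assume C [measurable]: "C \<in> sets G"
    then have CM [measurable]: "C \<in> sets M"
      using GM by (auto simp: subalgebra_def)
    \<comment> \<open>\<open>h\<close> is orthogonal to the indicators of \<open>H\<close> by conditional independence, so
      \<open>E[h | H] = 0\<close>; this replaces an induction over the \<open>H\<close>-measurable functions.\<close>
    define h :: "'a \<Rightarrow> real" where "h x = indicator C x * indicator B x - indicator C x * q x" for x
    have CB_int: "integrable M (\<lambda>x. indicator C x * indicator B x :: real)"
      by (rule mult_ind_int[OF ind_int[OF CM] BM])
    have Cq_int: "integrable M (\<lambda>x. indicator C x * q x)"
      by (rule mult_q_int[OF ind_int[OF CM]])
    have h_int: "integrable M h"
      unfolding h_def by (rule Bochner_Integration.integrable_diff[OF CB_int Cq_int])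
    have h_0: "AE x in M. real_cond_exp M H h x = 0"
    proof (rule H.real_cond_exp_charact)
      \<comment> \<open>The integral of \<open>h\<close> over \<open>A\<close> vanishes:
        \<open>indicator C\<close> is \<open>G\<close>-measurable, so
        \<open>indicator (A \<inter> B)\<close> may be replaced by its conditional expectation,
        which factorises by \<open>ci\<close>. The factor belonging to \<open>B\<close> is
        \<open>q\<close>, again \<open>G\<close>-measurable, so the other factor may be turned back
        into \<open>indicator A\<close>.\<close>
      fix A assume A: "A \<in> sets H"
      then have AM: "A \<in> sets M"
        using HM by (auto simp: subalgebra_def)
      have ABM: "A \<inter> B \<in> sets M"
        using AM BM by auto
      have "(\<integral>x. indicator C x * indicator (A \<inter> B) x \<partial>M)
          = (\<integral>x. indicator C x * real_cond_exp M G (indicator (A \<inter> B)) x \<partial>M)"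
        by (rule G.real_cond_exp_intg(2)[symmetric])
          (use mult_ind_int[OF ind_int[OF CM] ABM] ABM in auto)
      also have "\<dots> = (\<integral>x. (indicator C x * q x) * real_cond_exp M G (indicator A) x \<partial>M)"
      proof (rule integral_cong_AE)
        show "AE x in M. indicator C x * real_cond_exp M G (indicator (A \<inter> B)) x
            = indicator C x * q x * real_cond_exp M G (indicator A) x"
          using ci A B unfolding cond_indep_sigma_def q_def by fastforce
      qed measurable
      also have "\<dots> = (\<integral>x. (indicator C x * q x) * indicator A x \<partial>M)"
      proof (rule G.real_cond_exp_intg(2))
        show "integrable M (\<lambda>x. indicator C x * q x * indicator A x)"
          by (rule mult_ind_int[OF Cq_int AM])
        show "(\<lambda>x. indicator C x * q x) \<in> borel_measurable G"
          by measurable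
        show "indicator A \<in> borel_measurable M"
          using AM by measurable
      qed
      finally have eq: "(\<integral>x. indicator C x * indicator (A \<inter> B) x \<partial>M)
          = (\<integral>x. (indicator C x * q x) * indicator A x \<partial>M)" .
      have "(\<integral>x\<in>A. h x \<partial>M) = (\<integral>x. indicator C x * indicator (A \<inter> B) x
          - (indicator C x * q x) * indicator A x \<partial>M)"
        unfolding set_lebesgue_integral_def h_def
        by (rule Bochner_Integration.integral_cong) (auto simp: indicator_def)
      also have "\<dots> = 0"
        using mult_ind_int[OF ind_int[OF CM] ABM] mult_ind_int[OF Cq_int AM] eq
        by (subst Bochner_Integration.integral_diff) auto
      finally show "(\<integral>x\<in>A. h x \<partial>M) = (\<integral>x\<in>A. 0 \<partial>M)"
        by (simp add: set_lebesgue_integral_def)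
    qed (use h_int in auto)
    have fCB: "integrable M (\<lambda>x. f x * indicator C x * indicator B x)"
      by (rule mult_ind_int[OF mult_ind_int[OF f_int CM] BM])
    have fCq: "integrable M (\<lambda>x. f x * indicator C x * q x)"
      by (rule mult_q_int[OF mult_ind_int[OF f_int CM]])
    have f_M [measurable]: "f \<in> borel_measurable M"
      using f_int by simp
    have fh_int: "integrable M (\<lambda>x. f x * h x)"
      using Bochner_Integration.integrable_diff[OF fCB fCq]
      by (simp add: h_def algebra_simps)
    \<comment> \<open>Here the measurability of \<open>f\<close> with respect to \<open>H\<close>
      enters: it allows \<open>h\<close> to be replaced by its conditional expectation given
      \<open>H\<close>, which is 0.\<close>
    have "(\<integral>x. f x * h x \<partial>M) = (\<integral>x. f x * real_cond_exp M H h x \<partial>M)"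
      by (rule H.real_cond_exp_intg(2)[symmetric]) (use fh_int f_H h_int in auto)
    also have "\<dots> = (\<integral>x. 0 \<partial>M)"
      by (rule integral_cong_AE) (use h_0 in auto)
    finally have fh_0: "(\<integral>x. f x * h x \<partial>M) = 0"
      by simp
    have "(\<integral>x. f x * indicator C x * indicator B x \<partial>M) - (\<integral>x. f x * indicator C x * q x \<partial>M)
        = (\<integral>x. f x * h x \<partial>M)"
      by (subst Bochner_Integration.integral_diff[OF fCB fCq, symmetric])
        (simp add: h_def algebra_simps)
    then have "(\<integral>x. f x * indicator C x * indicator B x \<partial>M) = (\<integral>x. indicator C x * q x * f x \<partial>M)"
      using fh_0 by (simp add: mult_ac)
    \<comment> \<open>The weight \<open>indicator C x * q x\<close> is \<open>G\<close>-measurable,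
      so \<open>f\<close> may be replaced by its conditional expectation given
      \<open>G\<close>.\<close>
    also have "\<dots> = (\<integral>x. indicator C x * q x * real_cond_exp M G f x \<partial>M)"
      by (rule G.real_cond_exp_intg(2)[symmetric]) (use fCq in \<open>auto simp: mult_ac\<close>)
    finally show "(\<integral>x\<in>C. f x * indicator B x \<partial>M) = (\<integral>x\<in>C. real_cond_exp M G f x * q x \<partial>M)"
      by (simp add: set_lebesgue_integral_def mult_ac)
  qed
  then show ?thesis
    by (simp add: q_def)
qed

lemma has_tail_limit_cond_indep:
  assumes "prob_space M"
    and GM: "subalgebra M G" and HM: "subalgebra M H" and KM: "subalgebra M K"
    and ci: "cond_indep_sigma M G H K"
    and B: "\<And>v. {x \<in> space M. X x > v} \<in> sets K"
    and f_int: "integrable M f" and f_H: "f \<in> borel_measurable H"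
    and lim: "has_tail_limit M G X f g"
  shows "AE \<omega> in M. g \<omega> = real_cond_exp M G f \<omega>"
proof -
  from lim obtain r
    where pos: "\<And>v. AE \<omega> in M. real_cond_exp M G (indicator {x \<in> space M. X x > v}) \<omega> > 0"
      and r: "\<And>v. AE \<omega> in M. r v \<omega> = event_cond_exp M G {x \<in> space M. X x > v} f \<omega>"
      and r_lim: "AE \<omega> in M. ((\<lambda>v. r v \<omega>) \<longlongrightarrow> g \<omega>) at_top"
    unfolding has_tail_limit_def by blast
  \<comment> \<open>By \<open>pos\<close> the denominator is nonzero almost surely, so the factor
    coming from the event cancels in the quotient.\<close>
  have "AE \<omega> in M. r v \<omega> = real_cond_exp M G f \<omega>" for v
    using pos[of v] r[of v]
      cond_indep_sigma_real_cond_exp_mult[OF assms(1) GM HM KM ci B[of v] f_int f_H]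
    by eventually_elim (simp add: event_cond_exp_def)
  \<comment> \<open>The exceptional null set depends on \<open>v\<close>. Integer thresholds give a
    common null set, and they still determine the limit at infinity.\<close>
  then have "AE \<omega> in M. \<forall>n. r (real n) \<omega> = real_cond_exp M G f \<omega>"
    by (simp add: AE_all_countable)
  with r_lim show ?thesis
  proof eventually_elim
    case (elim \<omega>)
    have "(\<lambda>n. r (real n) \<omega>) \<longlonglongrightarrow> g \<omega>"
      using elim(1) filterlim_real_sequentially by (rule filterlim_compose)
    then show ?case
      using elim(2) by (simp add: LIMSEQ_const_iff)
  qed
qed

theorem propositionS1:
  fixes M :: "'w measure"
    and X Y :: "int \<Rightarrow> 'w \<Rightarrow> real"
    and Z :: "int \<Rightarrow> 'w \<Rightarrow> 'z::euclidean_space"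
    and NX :: "'e measure" and NY :: "'f measure"
    and epsX :: "int \<Rightarrow> 'w \<Rightarrow> 'e" and epsY :: "int \<Rightarrow> 'w \<Rightarrow> 'f"
    and qX qY p :: nat
    and hX :: "(nat \<Rightarrow> real) \<times> (nat \<Rightarrow> real) \<times> (nat \<Rightarrow> 'z) \<times> 'e \<Rightarrow> real"
    and hY :: "(nat \<Rightarrow> real) \<times> (nat \<Rightarrow> real) \<times> (nat \<Rightarrow> 'z) \<times> 'f \<Rightarrow> real"
    and D :: "real measure" and F :: "real \<Rightarrow> real"
  assumes "prob_space M"
    and "\<And>t. X t \<in> borel_measurable M"
    and "\<And>t. Y t \<in> borel_measurable M"
    and "\<And>t. Z t \<in> borel_measurable M"
    and "\<And>t. epsX t \<in> measurable M NX"
    and "\<And>t. epsY t \<in> measurable M NY"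
    and "\<And>t. \<exists>u. {u<..} \<subseteq> law_support (distr M borel (X t))"
    and "\<And>t. \<exists>u. {u<..} \<subseteq> law_support (distr M borel (Y t))"
    and "hX \<in> borel_measurable
           (lag_space qX \<Otimes>\<^sub>M lag_space qX \<Otimes>\<^sub>M lag_space qX \<Otimes>\<^sub>M NX)"
    and "hY \<in> borel_measurable
           (lag_space qY \<Otimes>\<^sub>M lag_space qY \<Otimes>\<^sub>M lag_space qY \<Otimes>\<^sub>M NY)"
    and "\<And>t. AE \<omega> in M. X t \<omega> =
           hX (lag_vec qX X t \<omega>, lag_vec qX Y t \<omega>, lag_vec qX Z t \<omega>, epsX t \<omega>)"
    and "\<And>t. AE \<omega> in M. Y t \<omega> =
           hY (lag_vec qY X t \<omega>, lag_vec qY Y t \<omega>, lag_vec qY Z t \<omega>, epsY t \<omega>)"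
    and "real_distribution D" and "F = cdf D"
    and "\<And>x. F x < 1"
    and "p \<ge> 1"
    and "\<And>t. Gamma_exists M X Y Z F p t"
  shows "(ext_causes M X Y Z F p \<longrightarrow> tail_causes M X Y Z F p) \<and>
         (tail_causes M X Y Z F p \<longrightarrow> sims_causes M X Y Z)"
proof -
  interpret prob_space M by fact
  interpret D: real_distribution D by fact
  note X = assms(2) and Y = assms(3) and Z = assms(4)
  let ?G = "past_sigma M X Y Z" and ?f = "future_max F Y p"
  let ?H = "\<lambda>t. sigma (space M) (family_sets M Y {t<..})"
  let ?K = "\<lambda>t. sigma (space M) (family_sets M X {t})"
  have GM: "subalgebra M (?G t)" for t
    unfolding past_sigma_def
    using family_sets_subset_sets[of X M] family_sets_subset_sets[of Y M]
      family_sets_subset_sets[of Z M] X Y Z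
    by (intro subalgebra_sigma_generated) auto
  have HM: "subalgebra M (?H t)" and KM: "subalgebra M (?K t)" for t
    by (rule subalgebra_sigma_generated, rule family_sets_subset_sets, fact)+
  have F_mono: "mono F"
    by (simp add: \<open>F = cdf D\<close> monoI D.cdf_nondecreasing)
  have F_borel: "F \<in> borel_measurable borel"
    by (rule borel_measurable_mono[OF F_mono])
  \<comment> \<open>The maximum starts at lag 1, so every \<open>t + int k\<close> lies strictly
    after \<open>t\<close> and the value is a function of the future of \<open>Y\<close> alone.
    Monotonicity makes \<open>F\<close> Borel.\<close>
  have f_H: "?f t \<in> borel_measurable (?H t)" for t
    unfolding future_max_def
  proof (rule borel_measurable_Max)
    fix k assume "k \<in> {1..p}"
    then have "Y (t + int k) \<in> borel_measurable (?H t)"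
      by (intro borel_measurable_sigma_family_sets Y) simp
    then show "(\<lambda>\<omega>. F (Y (t + int k) \<omega>)) \<in> borel_measurable (?H t)"
      using F_borel by (rule measurable_compose)
  qed simp
  \<comment> \<open>The bound stays strict because the maximum runs over a finite set, nonempty by
    \<open>p \<ge> 1\<close>.\<close>
  have f_less: "?f t \<omega> < 1" for t \<omega>
    using \<open>p \<ge> 1\<close> assms(15) by (simp add: future_max_def)
  have f_ge: "0 \<le> ?f t \<omega>" for t \<omega>
  proof -
    have "0 \<le> F (Y (t + int 1) \<omega>)"
      by (simp add: \<open>F = cdf D\<close> D.cdf_nonneg)
    also have "\<dots> \<le> ?f t \<omega>"
      unfolding future_max_def
      by (rule Max_ge[OF _ imageI[where x = 1]]) (use \<open>p \<ge> 1\<close> in auto)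
    finally show ?thesis .
  qed
  have f_int: "integrable M (?f t)" for t
    by (rule integrable_const_bound[where B = 1])
      (use f_less f_ge measurable_from_subalg[OF HM f_H] in \<open>auto intro: less_imp_le\<close>)
  \<comment> \<open>\<open>Gamma_tail\<close> is a Hilbert choice; existence of the limit guarantees
    that the chosen function really is one.\<close>
  have Gamma: "has_tail_limit M (?G t) (X t) (?f t) (Gamma_tail M X Y Z F p t)" for t
    using someI_ex[OF assms(17)[of t, unfolded Gamma_exists_def]]
    unfolding Gamma_tail_def .
  \<comment> \<open>Strictness survives conditioning without a uniform gap below 1: on a set of
    \<open>?G t\<close> of positive probability where the conditional expectation was at least 1,
    the integral of \<open>?f t\<close> would have to reach the probability of that set, although
    \<open>?f t\<close> is below 1 everywhere.\<close>
  have baseline_less: "AE \<omega> in M. Gamma_baseline M X Y Z F p t \<omega> < 1" for t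
  proof -
    interpret G: finite_measure_subalgebra M "?G t"
      by (rule finite_measure_subalgebraI[OF finite_measure_axioms GM])
    show ?thesis
      unfolding Gamma_baseline_def by (rule G.real_cond_exp_less_c[OF f_int]) (simp add: f_less)
  qed
  show ?thesis
  proof (intro conjI impI)
    assume "ext_causes M X Y Z F p"
    then obtain t where one: "AE \<omega> in M. Gamma_tail M X Y Z F p t \<omega> = 1"
      unfolding ext_causes_def by blast
    have "\<not> (AE \<omega> in M. Gamma_tail M X Y Z F p t \<omega> = Gamma_baseline M X Y Z F p t \<omega>)"
    proof
      assume "AE \<omega> in M. Gamma_tail M X Y Z F p t \<omega> = Gamma_baseline M X Y Z F p t \<omega>"
      with one baseline_less[of t] have "AE \<omega> in M. False"
        by eventually_elim simp
      then show False
        by simp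
    qed
    then show "tail_causes M X Y Z F p"
      unfolding tail_causes_def by blast
  next
    assume tail: "tail_causes M X Y Z F p"
    show "sims_causes M X Y Z"
    proof (rule ccontr)
      assume "\<not> sims_causes M X Y Z"
      then have ci: "cond_indep_sigma M (?G t) (?H t) (?K t)" for t
        unfolding sims_causes_def by blast
      \<comment> \<open>The conditioning events of the tail coefficient belong to the sigma-algebra
        of \<open>X t\<close>, so the factorisation applies to each threshold.\<close>
      have X_K: "{x \<in> space M. X t x > v} \<in> sets (?K t)" for t v
        using borel_measurable_sigma_family_sets[of X M t "{t}", OF X]
        by (simp add: borel_measurable_iff_greater space_measure_of_conv)
      have "AE \<omega> in M. Gamma_tail M X Y Z F p t \<omega> = Gamma_baseline M X Y Z F p t \<omega>" for t
        unfolding Gamma_baseline_def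
        by (rule has_tail_limit_cond_indep[OF \<open>prob_space M\<close> GM HM KM ci X_K f_int f_H Gamma])
      with tail show False
        unfolding tail_causes_def by blast
    qed
  qed
qed

end
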